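(* Let $P$ be a partially ordered pattern (a partial order on $\{1,\ldots,k\}$). The permutation class $\operatorname{Av}(P)$ has a regular insertion encoding if and only if $P$ is bipartite, i.e. $P$ has height at most $2$ (it contains no chain $a<_P b<_P c$ of three elements).
   Context: A permutation $\pi$ of size $n$ contains the POP $P$ if there are indices $i_1<i_2<\cdots<i_k$ such that $\pi(i_a)<\pi(i_b)$ whenever $a<_P b$; $\operatorname{Av}(P)$ is the set of all permutations (of all sizes) avoiding $P$. Insertion encoding: a permutation of size $n$ is built by inserting the values $1,2,\ldots,n$ in increasing order into a configuration, a word over the symbols $\bullet$ (placed entry) and $\diamond$ (slot), starting from the single slot $\diamond$. At step $j$ the value $j$ is inserted into the $i$-th slot from the left by one of four operations: $f_i$ replaces that slot by $\bullet$, $l_i$ by $\bullet\diamond$, $r_i$ by $\diamond\bullet$, $m_i$ by $\diamond\bullet\diamond$; after $n$ steps no slots remain and the left-to-right sequence of inserted values is the permutation. Every permutation has a unique such encoding as a word over the letters $\{f_i,l_i,r_i,m_i : i\ge 1\}$. A permutation class has a regular insertion encoding if the set of encodings of its members is a regular language over a finite alphabet (in particular only finitely many letters occur). *)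

theory Defs
  imports "HOL-Combinatorics.Multiset_Permutations"
begin

text \<open>Permutations in one-line notation, of all sizes (including the empty one);
  entries and positions are numbered from 1.\<close>

definition perms :: "nat list set" where
  "perms = (\<Union>n. permutations_of_set {1..n})"

definition entry :: "nat list \<Rightarrow> nat \<Rightarrow> nat" where
  "entry \<pi> i = \<pi> ! (i - 1)"

text \<open>A POP is a (reflexive) partial order \<open>P\<close> on \<open>{1..k}\<close>.\<close>

definition pop_less :: "nat rel \<Rightarrow> nat \<Rightarrow> nat \<Rightarrow> bool" where
  "pop_less P a b \<longleftrightarrow> (a, b) \<in> P \<and> a \<noteq> b"

definition contains_pop :: "nat list \<Rightarrow> nat \<Rightarrow> nat rel \<Rightarrow> bool" where
  "contains_pop \<pi> k P \<longleftrightarrow>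
     (\<exists>i :: nat \<Rightarrow> nat. strict_mono_on {1..k} i \<and> i ` {1..k} \<subseteq> {1..length \<pi>} \<and>
        (\<forall>a\<in>{1..k}. \<forall>b\<in>{1..k}. pop_less P a b \<longrightarrow> entry \<pi> (i a) < entry \<pi> (i b)))"

definition Av :: "nat \<Rightarrow> nat rel \<Rightarrow> nat list set" where
  "Av k P = {\<pi> \<in> perms. \<not> contains_pop \<pi> k P}"

definition bipartite_pop :: "nat rel \<Rightarrow> bool" where
  "bipartite_pop P \<longleftrightarrow> \<not> (\<exists>a b c. pop_less P a b \<and> pop_less P b c)"

text \<open>A configuration records with each placed entry the value inserted there.\<close>

datatype symbol = Slot | Placed nat

datatype letter = Lf nat | Ll nat | Lr nat | Lm nat

fun slot_index :: "letter \<Rightarrow> nat" where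
  "slot_index (Lf i) = i"
| "slot_index (Ll i) = i"
| "slot_index (Lr i) = i"
| "slot_index (Lm i) = i"

fun replacement :: "letter \<Rightarrow> nat \<Rightarrow> symbol list" where
  "replacement (Lf i) j = [Placed j]"
| "replacement (Ll i) j = [Placed j, Slot]"
| "replacement (Lr i) j = [Slot, Placed j]"
| "replacement (Lm i) j = [Slot, Placed j, Slot]"

text \<open>Inserting the value \<open>j\<close> by the letter \<open>x\<close>; slots are numbered from 1, so no letter
  of index 0 is ever applicable.\<close>

definition insertion_step :: "nat \<Rightarrow> letter \<Rightarrow> symbol list \<Rightarrow> symbol list \<Rightarrow> bool" where
  "insertion_step j x c c' \<longleftrightarrow>
     (\<exists>u v. c = u @ [Slot] @ v \<and> slot_index x = Suc (count_list u Slot) \<and>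
            c' = u @ replacement x j @ v)"

inductive builds :: "letter list \<Rightarrow> symbol list \<Rightarrow> bool" where
  start: "builds [] [Slot]"
| step: "builds w c \<Longrightarrow> insertion_step (Suc (length w)) x c c' \<Longrightarrow> builds (w @ [x]) c'"

text \<open>The empty permutation has no encoding, since the initial configuration has a slot.\<close>

definition encodes :: "letter list \<Rightarrow> nat list \<Rightarrow> bool" where
  "encodes w \<pi> \<longleftrightarrow> builds w (map Placed \<pi>)"

definition encodings :: "nat list set \<Rightarrow> letter list set" where
  "encodings C = {w. \<exists>\<pi>\<in>C. encodes w \<pi>}"

text \<open>Acceptance by a deterministic finite automaton over a finite alphabet \<open>\<Sigma>\<close>; taking
  states to be natural numbers loses no generality.\<close>

definition regular_language :: "'a list set \<Rightarrow> bool" where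
  "regular_language L \<longleftrightarrow>
     (\<exists>(\<Sigma> :: 'a set) (Q :: nat set) q0 F (\<delta> :: nat \<Rightarrow> 'a \<Rightarrow> nat).
        finite \<Sigma> \<and> finite Q \<and> q0 \<in> Q \<and> F \<subseteq> Q \<and> (\<forall>q\<in>Q. \<forall>x\<in>\<Sigma>. \<delta> q x \<in> Q) \<and>
        L = {w \<in> lists \<Sigma>. foldl \<delta> q0 w \<in> F})"

definition has_regular_insertion_encoding :: "nat list set \<Rightarrow> bool" where
  "has_regular_insertion_encoding C \<longleftrightarrow> regular_language (encodings C)"

end

theory Submission
  imports Defs "HOL-Library.Sublist"
begin

text \<open>In a regular encoding, the state reached by a prefix of an accepted word determines the number
  of open slots, so that number is bounded. If \<open>P\<close> has a chain \<open>a < b < c\<close>, then \<open>Av(P)\<close> contains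
  permutations in which \<open>n\<close> low entries and \<open>n + 1\<close> high entries alternate, each kind being
  monotone against the order in which \<open>a, b\<close> (respectively \<open>b, c\<close>) occur as positions; these open
  \<open>n + 1\<close> slots. Conversely, if \<open>P\<close> has height at most two, then a configuration with more than \<open>k\<close>
  slots can only be completed to permutations containing \<open>P\<close>. With boundedly many slots, a finite
  automaton can keep track of all ways in which inserted entries may play the roles of elements of
  \<open>P\<close>, by the subset construction.\<close>

section \<open>Configurations\<close>

fun vals :: "symbol list \<Rightarrow> nat list" where
  "vals [] = []"
| "vals (Slot # c) = vals c"
| "vals (Placed x # c) = x # vals c"

lemma vals_append [simp]: "vals (c @ d) = vals c @ vals d"
  by (induction c rule: vals.induct) auto

lemma vals_map_Placed [simp]: "vals (map Placed \<pi>) = \<pi>"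
  by (induction \<pi>) auto

lemma set_vals: "x \<in> set (vals c) \<longleftrightarrow> Placed x \<in> set c"
  by (induction c rule: vals.induct) auto

lemma map_Placed_vals: "Slot \<notin> set c \<Longrightarrow> map Placed (vals c) = c"
  by (induction c rule: vals.induct) auto

lemma length_eq_slots_plus_vals: "length c = count_list c Slot + length (vals c)"
  by (induction c rule: vals.induct) auto

lemma count_Slot_map_Placed [simp]: "count_list (map Placed \<pi>) Slot = 0"
  by (induction \<pi>) auto

lemma insertion_stepE:
  assumes "insertion_step j x c c'"
  obtains u v where "c = u @ [Slot] @ v" "slot_index x = Suc (count_list u Slot)"
    "c' = u @ replacement x j @ v"
  using assms unfolding insertion_step_def by blast

text \<open>The number of slots to its left determines a slot, so a letter acts on a configuration
  in at most one way; hence building is deterministic.\<close>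

lemma append_Slot_eqD:
  assumes "u @ Slot # v = u' @ Slot # v'" "count_list u Slot = count_list u' Slot"
  shows "u = u' \<and> v = v'"
  using assms
proof (induction u arbitrary: u')
  case Nil
  then show ?case by (cases u') auto
next
  case (Cons s u)
  then show ?case by (cases u') (auto split: if_splits)
qed

lemma builds_Nil: "builds [] c \<longleftrightarrow> c = [Slot]"
  by (auto intro: builds.start elim: builds.cases)

lemma builds_snoc:
  "builds (w @ [x]) c' \<longleftrightarrow> (\<exists>c. builds w c \<and> insertion_step (Suc (length w)) x c c')"
  by (auto intro: builds.step elim: builds.cases)

lemma builds_unique: "builds w c \<Longrightarrow> builds w c' \<Longrightarrow> c = c'"
proof (induction w arbitrary: c c' rule: rev_induct)
  case Nil
  then show ?case by (simp add: builds_Nil)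
next
  case (snoc x w)
  then obtain d where "insertion_step (Suc (length w)) x d c" "insertion_step (Suc (length w)) x d c'"
    unfolding builds_snoc by blast
  then show ?case by (elim insertion_stepE) (auto dest: append_Slot_eqD)
qed

lemma builds_prefix: "builds (w @ v) d \<Longrightarrow> \<exists>c. builds w c"
  by (induction v arbitrary: d rule: rev_induct) (auto simp: builds_snoc simp flip: append_assoc)

lemma vals_replacement [simp]: "vals (replacement x j) = [j]"
  by (cases x) auto

lemma builds_vals: "builds w c \<Longrightarrow> distinct (vals c) \<and> set (vals c) = {1..length w}"
proof (induction rule: builds.induct)
  case (step w c x c')
  from step(2) show ?case
  proof (rule insertion_stepE)
    fix u v
    assume c: "c = u @ [Slot] @ v" "c' = u @ replacement x (Suc (length w)) @ v"
    have eq: "set (vals u) \<union> set (vals v) = {1..length w}" using step.IH c by simp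
    moreover have "Suc (length w) \<notin> set (vals u)" "Suc (length w) \<notin> set (vals v)"
      using eq by (metis UnCI atLeastAtMost_iff Suc_n_not_le_n)+
    moreover have "{1..length (w @ [x])} = insert (Suc (length w)) {1..length w}" by auto
    ultimately show ?thesis using step.IH c by simp
  qed
qed auto

lemma Placed_in_builds: "builds w c \<Longrightarrow> Placed x \<in> set c \<longleftrightarrow> 1 \<le> x \<and> x \<le> length w"
  using builds_vals[of w c] set_vals[of x c] by auto

lemma encodes_perms: "encodes w \<pi> \<Longrightarrow> \<pi> \<in> perms"
  unfolding encodes_def perms_def permutations_of_set_def
  using builds_vals by fastforce

lemma builds_slotless_encodes: "builds w c \<Longrightarrow> Slot \<notin> set c \<Longrightarrow> encodes w (vals c)"
  by (simp add: encodes_def map_Placed_vals)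

fun slot_change :: "letter \<Rightarrow> int" where
  "slot_change (Lf i) = -1"
| "slot_change (Ll i) = 0"
| "slot_change (Lr i) = 0"
| "slot_change (Lm i) = 1"

text \<open>The change caused by a letter does not depend on where it acts, so the word alone
  determines the number of slots.\<close>

lemma builds_slot_count: "builds w c \<Longrightarrow> int (count_list c Slot) = 1 + sum_list (map slot_change w)"
proof (induction rule: builds.induct)
  case (step w c x c')
  from step(2) show ?case
    by (rule insertion_stepE) (use step.IH in \<open>cases x; auto\<close>)
qed auto

section \<open>Regular encodings use boundedly many slots\<close>

text \<open>The letters still to be read determine how many slots are left, so a state from which
  acceptance is possible determines the number of slots.\<close>

lemma regular_encoding_bounded_slots:
  assumes "has_regular_insertion_encoding C"
  shows "\<exists>B. \<forall>w v c. w @ v \<in> encodings C \<longrightarrow> builds w c \<longrightarrow> count_list c Slot \<le> B"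
proof -
  let ?L = "encodings C"
  obtain \<Sigma> Q q0 F and \<delta> :: "nat \<Rightarrow> letter \<Rightarrow> nat" where fin: "finite Q" and q0: "q0 \<in> Q"
    and \<delta>: "\<forall>q\<in>Q. \<forall>x\<in>\<Sigma>. \<delta> q x \<in> Q"
    and L: "?L = {w \<in> lists \<Sigma>. foldl \<delta> q0 w \<in> F}"
    using assms unfolding has_regular_insertion_encoding_def regular_language_def by blast
  have reach: "foldl \<delta> q0 w \<in> Q" if "w \<in> lists \<Sigma>" for w
    using that by (induction w rule: rev_induct) (auto simp: q0 \<delta>)
  \<comment> \<open>For a word that builds a configuration this is the number of open slots minus
    one, hence -1 for a complete encoding.\<close>
  define bal where "bal w = sum_list (map slot_change w)" for w
  have bal: "bal w = - 1" if "w \<in> ?L" for w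
    using that builds_slot_count by (fastforce simp: encodings_def encodes_def bal_def)
  \<comment> \<open>Prefixes reaching the same state accept the same continuations; cancelling the
    common suffix \<open>v\<close> from two words of balance -1 equates the balances.\<close>
  have same: "bal w = bal w'"
    if "w @ v \<in> ?L" "w' @ v' \<in> ?L" "foldl \<delta> q0 w = foldl \<delta> q0 w'" for w w' v v'
  proof -
    have "w' @ v \<in> ?L" using that by (simp add: L)
    then show ?thesis using bal[of "w @ v"] bal[of "w' @ v"] that(1) by (simp add: bal_def)
  qed
  \<comment> \<open>By \<open>same\<close> the choice is forced at states on accepting runs;
    elsewhere the value is arbitrary and can only enlarge \<open>B\<close>.\<close>
  define g where "g q = (SOME n. \<exists>w v. w @ v \<in> ?L \<and> foldl \<delta> q0 w = q \<and> n = bal w)" for q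
  have g: "g (foldl \<delta> q0 w) = bal w" if "w @ v \<in> ?L" for w v
    unfolding g_def by (rule some_equality) (use that same in blast)+
  define B where "B = Max (insert 0 (g ` Q))"
  have "count_list c Slot \<le> nat (1 + B)" if "w @ v \<in> ?L" "builds w c" for w v c
  proof -
    have "w \<in> lists \<Sigma>" using that(1) by (simp add: L)
    then have "bal w \<le> B" using reach g[OF that(1)] fin unfolding B_def
      by (metis Max_ge finite_imageI finite_insert imageI insertCI)
    then show ?thesis using builds_slot_count[OF that(2)] by (simp add: bal_def)
  qed
  then show ?thesis by blast
qed

section \<open>Chains of length three\<close>

text \<open>\<open>Lm\<close> is applied \<open>n\<close> times to the last slot, so each new
  maximum lies to the right of all earlier entries while a slot stays behind on its left.\<close>

lemma builds_many_slots_increasing: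
  "\<exists>w u. length w = n \<and> builds w (u @ [Slot]) \<and> count_list u Slot = n \<and> sorted_wrt (<) (vals u)"
proof (induction n)
  case 0
  have "builds [] ([] @ [Slot])" by (simp add: builds.start)
  then show ?case by (intro exI[of _ "[]"]) auto
next
  case (Suc n)
  then obtain w u where w: "length w = n" "builds w (u @ [Slot])" "count_list u Slot = n"
    "sorted_wrt (<) (vals u)" by blast
  have "insertion_step (Suc (length w)) (Lm (Suc n)) (u @ [Slot]) ((u @ [Slot, Placed (Suc n)]) @ [Slot])"
    unfolding insertion_step_def using w by (intro exI[of _ u] exI[of _ "[]"]) simp
  from builds.step[OF w(2) this] show ?case
    using w Placed_in_builds[OF w(2)]
    by (intro exI[of _ "w @ [Lm (Suc n)]"] exI[of _ "u @ [Slot, Placed (Suc n)]"])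
      (auto simp: sorted_wrt_append set_vals less_Suc_eq_le)
qed

text \<open>The mirror image: \<open>Lm 1\<close> always splits the leftmost slot.\<close>

lemma builds_many_slots_decreasing:
  "\<exists>w v. length w = n \<and> builds w (Slot # v) \<and> count_list v Slot = n \<and> sorted_wrt (>) (vals v)"
proof (induction n)
  case 0
  have "builds [] (Slot # [])" by (simp add: builds.start)
  then show ?case by (intro exI[of _ "[]"]) auto
next
  case (Suc n)
  then obtain w v where w: "length w = n" "builds w (Slot # v)" "count_list v Slot = n"
    "sorted_wrt (>) (vals v)" by blast
  have "insertion_step (Suc (length w)) (Lm 1) (Slot # v) (Slot # Placed (Suc n) # Slot # v)"
    unfolding insertion_step_def using w by (intro exI[of _ "[]"] exI[of _ v]) simp
  from builds.step[OF w(2) this] show ?case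
    using w Placed_in_builds[OF w(2)]
    by (intro exI[of _ "w @ [Lm 1]"] exI[of _ "Placed (Suc n) # Slot # v"])
      (auto simp: set_vals less_Suc_eq_le)
qed

text \<open>Slots are filled from left to right by \<open>Lf 1\<close>; \<open>u\<close> is the part
  already scanned, and \<open>j\<close> separates the entries of \<open>v\<close> from the fillers.
  The last conjunct carries the induction: later fillers exceed the current one.\<close>

lemma builds_fill_increasing:
  assumes "builds w (u @ v)" "Slot \<notin> set u" "\<forall>x\<in>set (vals v). x \<le> j" "j \<le> length w"
  shows "\<exists>w' d. builds (w @ w') (u @ d) \<and> Slot \<notin> set d \<and>
    filter (\<lambda>x. x \<le> j) (vals d) = vals v \<and> sorted_wrt (<) (filter (\<lambda>x. j < x) (vals d)) \<and>
    (\<forall>x\<in>set (vals d). j < x \<longrightarrow> length w < x)"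
  using assms
proof (induction v arbitrary: u w)
  case Nil
  then show ?case by (intro exI[of _ "[]"]) auto
next
  case (Cons s v)
  show ?case
  proof (cases s)
    case (Placed x)
    obtain w' d where "builds (w @ w') ((u @ [s]) @ d)" "Slot \<notin> set d"
      "filter (\<lambda>x. x \<le> j) (vals d) = vals v" "sorted_wrt (<) (filter (\<lambda>x. j < x) (vals d))"
      "\<forall>x\<in>set (vals d). j < x \<longrightarrow> length w < x"
      using Cons.IH[of w "u @ [s]"] Cons.prems Placed by auto
    then show ?thesis using Placed Cons.prems(3)
      by (intro exI[of _ w'] exI[of _ "s # d"]) auto
  next
    case Slot
    let ?j = "Suc (length w)"
    have "insertion_step ?j (Lf 1) (u @ s # v) ((u @ [Placed ?j]) @ v)"
      unfolding insertion_step_def using Slot Cons.prems(2)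
      by (intro exI[of _ u] exI[of _ v]) (simp add: count_list_0_iff)
    from builds.step[OF Cons.prems(1) this] obtain w' d where
      "builds ((w @ [Lf 1]) @ w') ((u @ [Placed ?j]) @ d)" "Slot \<notin> set d"
      "filter (\<lambda>x. x \<le> j) (vals d) = vals v" "sorted_wrt (<) (filter (\<lambda>x. j < x) (vals d))"
      "\<forall>x\<in>set (vals d). j < x \<longrightarrow> length (w @ [Lf 1]) < x"
      using Cons.IH[of "w @ [Lf 1]" "u @ [Placed ?j]"] Cons.prems Slot by auto
    then show ?thesis using Slot Cons.prems(4)
      by (intro exI[of _ "Lf 1 # w'"] exI[of _ "Placed ?j # d"]) auto
  qed
qed

text \<open>Slots are filled from right to left instead, so the index is one more than the number of
  slots further left.\<close>

lemma builds_fill_decreasing: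
  assumes "builds w (v @ u)" "Slot \<notin> set u" "\<forall>x\<in>set (vals v). x \<le> j" "j \<le> length w"
  shows "\<exists>w' d. builds (w @ w') (d @ u) \<and> Slot \<notin> set d \<and>
    filter (\<lambda>x. x \<le> j) (vals d) = vals v \<and> sorted_wrt (>) (filter (\<lambda>x. j < x) (vals d)) \<and>
    (\<forall>x\<in>set (vals d). j < x \<longrightarrow> length w < x)"
  using assms
proof (induction v arbitrary: u w rule: rev_induct)
  case Nil
  then show ?case by (intro exI[of _ "[]"]) auto
next
  case (snoc s v)
  show ?case
  proof (cases s)
    case (Placed x)
    obtain w' d where "builds (w @ w') (d @ s # u)" "Slot \<notin> set d"
      "filter (\<lambda>x. x \<le> j) (vals d) = vals v" "sorted_wrt (>) (filter (\<lambda>x. j < x) (vals d))"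
      "\<forall>x\<in>set (vals d). j < x \<longrightarrow> length w < x"
      using snoc.IH[of w "s # u"] snoc.prems Placed by auto
    then show ?thesis using Placed snoc.prems(3)
      by (intro exI[of _ w'] exI[of _ "d @ [s]"]) auto
  next
    case Slot
    let ?j = "Suc (length w)" and ?x = "Lf (Suc (count_list v Slot))"
    have "insertion_step ?j ?x ((v @ [s]) @ u) (v @ Placed ?j # u)"
      unfolding insertion_step_def using Slot
      by (intro exI[of _ v] exI[of _ u]) simp
    from builds.step[OF snoc.prems(1) this] obtain w' d where
      "builds ((w @ [?x]) @ w') (d @ Placed ?j # u)" "Slot \<notin> set d"
      "filter (\<lambda>x. x \<le> j) (vals d) = vals v" "sorted_wrt (>) (filter (\<lambda>x. j < x) (vals d))"
      "\<forall>x\<in>set (vals d). j < x \<longrightarrow> length (w @ [?x]) < x"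
      using snoc.IH[of "w @ [?x]" "Placed ?j # u"] snoc.prems Slot by auto
    then show ?thesis using Slot snoc.prems(4)
      by (intro exI[of _ "?x # w'"] exI[of _ "d @ [Placed ?j]"]) (auto simp: sorted_wrt_append)
  qed
qed

text \<open>The first \<open>n\<close> insertions build the low half and open \<open>n + 1\<close>
  slots; each is then closed by one high entry, in a direction independent of the low half.\<close>

lemma builds_monotone_halves:
  assumes "R1 = (<) \<or> R1 = (>)" "R2 = (<) \<or> R2 = (>)"
  shows "\<exists>w v c \<pi>. builds w c \<and> n < count_list c Slot \<and> encodes (w @ v) \<pi> \<and>
    sorted_wrt R1 (filter (\<lambda>x. x \<le> n) \<pi>) \<and> sorted_wrt R2 (filter (\<lambda>x. n < x) \<pi>)"
proof -
  obtain w c where w: "length w = n" "builds w c" "n < count_list c Slot" "sorted_wrt R1 (vals c)"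
    using assms(1)
  proof
    assume "R1 = (<)"
    moreover obtain w u where "length w = n" "builds w (u @ [Slot])" "count_list u Slot = n"
      "sorted_wrt (<) (vals u)" using builds_many_slots_increasing by blast
    ultimately show thesis by (intro that[of w "u @ [Slot]"]) auto
  next
    assume "R1 = (>)"
    moreover obtain w v where "length w = n" "builds w (Slot # v)" "count_list v Slot = n"
      "sorted_wrt (>) (vals v)" using builds_many_slots_decreasing by blast
    ultimately show thesis by (intro that[of w "Slot # v"]) auto
  qed
  have le: "\<forall>x\<in>set (vals c). x \<le> n" using Placed_in_builds[OF w(2)] w(1) by (auto simp: set_vals)
  obtain v d where v: "builds (w @ v) d" "Slot \<notin> set d"
      "filter (\<lambda>x. x \<le> n) (vals d) = vals c" "sorted_wrt R2 (filter (\<lambda>x. n < x) (vals d))"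
    using assms(2)
  proof
    assume "R2 = (<)"
    then show thesis using builds_fill_increasing[of w "[]" c n] w le that by auto
  next
    assume "R2 = (>)"
    then show thesis using builds_fill_decreasing[of w c "[]" n] w le that by auto
  qed
  then show ?thesis using w builds_slotless_encodes[of "w @ v" d]
    by (intro exI[of _ w] exI[of _ v] exI[of _ c] exI[of _ "vals d"]) auto
qed

lemma sorted_wrt_filter_nth:
  assumes "sorted_wrt R (filter p xs)" "i < j" "j < length xs" "p (xs ! i)" "p (xs ! j)"
  shows "R (xs ! i) (xs ! j)"
  using assms
proof (induction xs arbitrary: i j)
  case (Cons x xs)
  then show ?case by (cases i; cases j) (auto split: if_splits)
qed simp

text \<open>Two of the three entries matching a chain lie in the same half, and that half is monotone
  in the wrong direction.\<close>

lemma monotone_halves_avoid: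
  assumes chain: "pop_less P a b" "pop_less P b c" and P: "P \<subseteq> {1..k} \<times> {1..k}"
    and low: "sorted_wrt (if a < b then (>) else (<)) (filter (\<lambda>x. x \<le> n) \<pi>)"
    and high: "sorted_wrt (if b < c then (>) else (<)) (filter (\<lambda>x. n < x) \<pi>)"
  shows "\<not> contains_pop \<pi> k P"
proof
  assume "contains_pop \<pi> k P"
  then obtain i where i: "strict_mono_on {1..k} i" "i ` {1..k} \<subseteq> {1..length \<pi>}"
    "\<forall>a\<in>{1..k}. \<forall>b\<in>{1..k}. pop_less P a b \<longrightarrow> entry \<pi> (i a) < entry \<pi> (i b)"
    unfolding contains_pop_def by blast
  have abc: "a \<in> {1..k}" "b \<in> {1..k}" "c \<in> {1..k}" "a \<noteq> b" "b \<noteq> c"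
    using chain P unfolding pop_less_def by auto
  define p where "p x = i x - 1" for x
  have mono: "p x < p y" if "x < y" "x \<in> {1..k}" "y \<in> {1..k}" for x y
  proof -
    have "i x < i y" using that by (intro strict_mono_onD[OF i(1)])
    moreover have "i x \<in> {1..length \<pi>}" using i(2) that by blast
    ultimately show ?thesis by (auto simp: p_def)
  qed
  have len: "p x < length \<pi>" if "x \<in> {1..k}" for x
  proof -
    have "i x \<in> {1..length \<pi>}" using i(2) that by blast
    then show ?thesis by (auto simp: p_def)
  qed
  have ent: "\<pi> ! p a < \<pi> ! p b" "\<pi> ! p b < \<pi> ! p c"
    using i(3) abc chain by (auto simp: entry_def p_def)
  have wrong: "\<not> (q (\<pi> ! p x) \<and> q (\<pi> ! p y))"
    if "sorted_wrt (if x < y then (>) else (<)) (filter q \<pi>)" "\<pi> ! p x < \<pi> ! p y"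
      "x \<in> {1..k}" "y \<in> {1..k}" "x \<noteq> y" for q x y
  proof (cases "x < y")
    case True
    then show ?thesis
      using sorted_wrt_filter_nth[of "(>)" q \<pi> "p x" "p y"] that mono[of x y] len[of y] by auto
  next
    case False
    then show ?thesis
      using sorted_wrt_filter_nth[of "(<)" q \<pi> "p y" "p x"] that mono[of y x] len[of x] by auto
  qed
  \<comment> \<open>The middle entry decides: if it is low, so is the smaller one matching
    \<open>a\<close>; if it is high, so is the larger one matching \<open>c\<close>.\<close>
  show False
  proof (cases "\<pi> ! p b \<le> n")
    case True
    then show False using wrong[OF low ent(1)] abc ent by auto
  next
    case False
    then show False using wrong[OF high ent(2)] abc ent by auto
  qed
qed

lemma regular_imp_bipartite:
  assumes P: "P \<subseteq> {1..k} \<times> {1..k}" and reg: "has_regular_insertion_encoding (Av k P)"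
  shows "bipartite_pop P"
proof (rule ccontr)
  assume "\<not> bipartite_pop P"
  then obtain a b c where chain: "pop_less P a b" "pop_less P b c"
    unfolding bipartite_pop_def by blast
  obtain B where B: "\<And>w v d. w @ v \<in> encodings (Av k P) \<Longrightarrow> builds w d \<Longrightarrow> count_list d Slot \<le> B"
    using regular_encoding_bounded_slots[OF reg] by blast
  \<comment> \<open>Splitting the values at \<open>B\<close> leaves more than \<open>B\<close> slots
    open after the low half.\<close>
  obtain w v d \<pi> where w: "builds w d" "B < count_list d Slot" "encodes (w @ v) \<pi>"
    "sorted_wrt (if a < b then (>) else (<)) (filter (\<lambda>x. x \<le> B) \<pi>)"
    "sorted_wrt (if b < c then (>) else (<)) (filter (\<lambda>x. B < x) \<pi>)"
  proof -
    have dir: "(if q then (>) else (<)) = (<) \<or> (if q then (>) else (<)) = ((>) :: nat \<Rightarrow> nat \<Rightarrow> bool)" for q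
      by simp
    show thesis using builds_monotone_halves[OF dir dir] that by blast
  qed
  have "\<pi> \<in> Av k P"
    using monotone_halves_avoid[OF chain P w(4,5)] encodes_perms[OF w(3)] by (simp add: Av_def)
  then have "w @ v \<in> encodings (Av k P)" using w(3) by (auto simp: encodings_def)
  then show False using B[OF _ w(1)] w(2) by fastforce
qed

section \<open>Marked configurations\<close>

text \<open>A finite state set of any type is renumbered along an injection into the naturals; the
  states used below are sets of marked configurations.\<close>

lemma regular_languageI:
  fixes Q :: "'s set"
  assumes "finite \<Sigma>" "finite Q" "q0 \<in> Q" "F \<subseteq> Q" "\<And>q x. q \<in> Q \<Longrightarrow> x \<in> \<Sigma> \<Longrightarrow> \<delta> q x \<in> Q"
  shows "regular_language {w \<in> lists \<Sigma>. foldl \<delta> q0 w \<in> F}"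
proof -
  obtain g :: "'s \<Rightarrow> nat" where g: "inj_on g Q"
    using finite_imp_inj_to_nat_seg[OF assms(2)] by blast
  define \<delta>' where "\<delta>' n x = g (\<delta> (the_inv_into Q g n) x)" for n x
  have run: "foldl \<delta> q0 w \<in> Q \<and> foldl \<delta>' (g q0) w = g (foldl \<delta> q0 w)" if "w \<in> lists \<Sigma>" for w
    using that by (induction w rule: rev_induct)
      (auto simp: assms \<delta>'_def the_inv_into_f_f[OF g])
  have "{w \<in> lists \<Sigma>. foldl \<delta> q0 w \<in> F} = {w \<in> lists \<Sigma>. foldl \<delta>' (g q0) w \<in> g ` F}"
    using run inj_on_image_mem_iff[OF g _ assms(4)] by (intro Collect_cong conj_cong refl) auto
  moreover have "\<forall>q\<in>g ` Q. \<forall>x\<in>\<Sigma>. \<delta>' q x \<in> g ` Q"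
    by (auto simp: \<delta>'_def the_inv_into_f_f[OF g] assms(5))
  ultimately show ?thesis unfolding regular_language_def using assms
    by (intro exI[of _ \<Sigma>] exI[of _ "g ` Q"] exI[of _ "g q0"] exI[of _ "g ` F"] exI[of _ \<delta>'])
      auto
qed

section \<open>Partial labellings of configurations by pattern elements\<close>

fun relabel :: "(nat \<Rightarrow> nat option) \<Rightarrow> symbol list \<Rightarrow> symbol list" where
  "relabel h [] = []"
| "relabel h (Slot # c) = Slot # relabel h c"
| "relabel h (Placed x # c) = (case h x of None \<Rightarrow> relabel h c | Some a \<Rightarrow> Placed a # relabel h c)"

lemma relabel_append [simp]: "relabel h (c @ d) = relabel h c @ relabel h d"
  by (induction h c rule: relabel.induct) (auto split: option.splits)

lemma count_Slot_relabel [simp]: "count_list (relabel h c) Slot = count_list c Slot"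
  by (induction h c rule: relabel.induct) (auto split: option.splits)

lemma Placed_in_relabel: "Placed a \<in> set (relabel h c) \<longleftrightarrow> (\<exists>x. Placed x \<in> set c \<and> h x = Some a)"
  by (induction h c rule: relabel.induct) (auto split: option.splits)

lemma relabel_cong:
  "(\<And>x. Placed x \<in> set c \<Longrightarrow> h x = h' x) \<Longrightarrow> relabel h c = relabel h' c"
  by (induction h c rule: relabel.induct) (auto split: option.splits)

text \<open>The inserted value matters only through \<open>h j\<close>, so a letter can act on
  marked configurations without knowing the value, which is unbounded.\<close>

lemma relabel_replacement: "relabel h (replacement x j) = relabel (\<lambda>_. h j) (replacement x i)"
  by (cases x) (auto split: option.splits)

text \<open>Used with \<open>(<)\<close> for the left-to-right order of the labels and with
  \<open>(\<noteq>)\<close> for their distinctness.\<close>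

lemma sorted_wrt_vals_relabel:
  "sorted_wrt R (vals (relabel h c)) \<longleftrightarrow>
    sorted_wrt (\<lambda>x y. \<forall>a b. h x = Some a \<longrightarrow> h y = Some b \<longrightarrow> R a b) (vals c)"
  by (induction h c rule: relabel.induct)
    (auto split: option.splits simp: set_vals Placed_in_relabel)

lemma distinct_iff_sorted_wrt: "distinct xs \<longleftrightarrow> sorted_wrt (\<noteq>) xs"
  by (induction xs) auto

text \<open>Relabelling neither creates nor removes slots, so a step on a marked configuration lifts
  to an insertion.\<close>

lemma relabel_eq_append_SlotE:
  assumes "relabel h c = u @ Slot # v"
  obtains u' v' where "c = u' @ Slot # v'" "relabel h u' = u" "relabel h v' = v"
proof -
  have "\<exists>u' v'. c = u' @ Slot # v' \<and> relabel h u' = u \<and> relabel h v' = v"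
    using assms
  proof (induction c arbitrary: u)
    case (Cons s c)
    show ?case
    proof (cases "s = Slot \<and> u = []")
      case True
      then show ?thesis using Cons.prems by (intro exI[of _ "[]"] exI[of _ c]) auto
    next
      case False
      obtain u1 where u1: "u = relabel h [s] @ u1" "relabel h c = u1 @ Slot # v"
        using Cons.prems False by (cases s; cases u) (auto split: option.splits)
      from Cons.IH[OF u1(2)] obtain u' v'
        where "c = u' @ Slot # v'" "relabel h u' = u1" "relabel h v' = v" by blast
      then show ?thesis using u1(1) relabel_append[of h "[s]" u']
        by (intro exI[of _ "s # u'"] exI[of _ v']) auto
    qed
  qed simp
  then show thesis using that by blast
qed

text \<open>A marked configuration keeps the slots and those placed entries that have been guessed to
  play the role of an element of \<open>P\<close>, written as \<open>Placed a\<close> with \<open>a\<close> that element.\<close>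

definition marked_configs :: "nat \<Rightarrow> nat \<Rightarrow> symbol list set" where
  "marked_configs k B =
    {m. set m \<subseteq> insert Slot (Placed ` {1..k}) \<and> count_list m Slot \<le> B \<and> distinct (vals m)}"

text \<open>\<open>l\<close> is the role guessed for the new entry, \<open>None\<close> if it has
  none. Values arrive in increasing order, so requiring the elements below \<open>b\<close> to be
  marked already expresses the inequalities of \<open>P\<close>. The value 0 is a dummy replaced by
  \<open>l\<close>.\<close>

definition mark_step :: "nat rel \<Rightarrow> letter \<Rightarrow> symbol list \<Rightarrow> symbol list \<Rightarrow> bool" where
  "mark_step P x m m' \<longleftrightarrow>
     (\<exists>u v l. m = u @ Slot # v \<and> slot_index x = Suc (count_list u Slot) \<and>
        m' = u @ relabel (\<lambda>_. l) (replacement x 0) @ v \<and>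
        (\<forall>a b. l = Some b \<longrightarrow> pop_less P a b \<longrightarrow> Placed a \<in> set m))"

text \<open>The subset construction for \<open>mark_step\<close>; runs that repeat a role or exceed
  \<open>B\<close> slots are discarded.\<close>

definition mark_transition ::
  "nat \<Rightarrow> nat rel \<Rightarrow> nat \<Rightarrow> symbol list set \<Rightarrow> letter \<Rightarrow> symbol list set" where
  "mark_transition k P B S x = {m' \<in> marked_configs k B. \<exists>m\<in>S. mark_step P x m m'}"

abbreviation markings :: "nat \<Rightarrow> nat rel \<Rightarrow> nat \<Rightarrow> letter list \<Rightarrow> symbol list set" where
  "markings k P B \<equiv> foldl (mark_transition k P B) {[Slot]}"

lemma markings_snoc:
  "m' \<in> markings k P B (w @ [x]) \<longleftrightarrow>
    m' \<in> marked_configs k B \<and> (\<exists>m\<in>markings k P B w. mark_step P x m m')"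
  by (simp add: mark_transition_def)

lemma finite_marked_configs: "finite (marked_configs k B)"
proof (rule finite_subset)
  show "marked_configs k B \<subseteq> {m. set m \<subseteq> insert Slot (Placed ` {1..k}) \<and> length m \<le> B + k}"
  proof safe
    fix m assume m: "m \<in> marked_configs k B"
    then have "set (vals m) \<subseteq> {1..k}" by (auto simp: marked_configs_def set_vals)
    then have "length (vals m) \<le> k"
      using m card_mono[of "{1..k}" "set (vals m)"] by (simp add: marked_configs_def distinct_card)
    then show "length m \<le> B + k"
      using m by (simp add: length_eq_slots_plus_vals[of m] marked_configs_def)
  qed (auto simp: marked_configs_def)
  show "finite {m. set m \<subseteq> insert Slot (Placed ` {1..k}) \<and> length m \<le> B + k}"
    by (intro finite_lists_length_le) simp
qed

text \<open>Each run of guesses defines a labelling, extended at every step by the guess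
  \<open>l\<close> at the new and largest value.\<close>

lemma markings_sound:
  assumes "m \<in> markings k P B w"
  shows "\<exists>c h. builds w c \<and> m = relabel h c \<and>
    (\<forall>y a b. Placed y \<in> set c \<longrightarrow> h y = Some b \<longrightarrow> pop_less P a b \<longrightarrow>
       (\<exists>x<y. Placed x \<in> set c \<and> h x = Some a))"
  using assms
proof (induction w arbitrary: m rule: rev_induct)
  case Nil
  then show ?case by (intro exI[of _ "[Slot]"]) (auto simp: builds_Nil)
next
  case (snoc x w)
  then obtain m0 where m0: "m0 \<in> markings k P B w" "mark_step P x m0 m"
    unfolding markings_snoc by blast
  from snoc.IH[OF m0(1)] obtain c h where c: "builds w c" "m0 = relabel h c"
    and ord: "\<And>y a b. \<lbrakk>Placed y \<in> set c; h y = Some b; pop_less P a b\<rbrakk> \<Longrightarrow>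
      \<exists>x<y. Placed x \<in> set c \<and> h x = Some a" by blast
  from m0(2) obtain u v l where uv: "m0 = u @ Slot # v" "slot_index x = Suc (count_list u Slot)"
    "m = u @ relabel (\<lambda>_. l) (replacement x 0) @ v"
    and l: "\<And>a b. l = Some b \<Longrightarrow> pop_less P a b \<Longrightarrow> Placed a \<in> set m0"
    unfolding mark_step_def by blast
  from uv(1) c(2) obtain u' v' where c': "c = u' @ Slot # v'" "relabel h u' = u" "relabel h v' = v"
    by (metis relabel_eq_append_SlotE)
  let ?j = "Suc (length w)"
  define h' where "h' = h(?j := l)"
  define d where "d = u' @ replacement x ?j @ v'"
  have old: "h' y = h y \<and> y < ?j" if "Placed y \<in> set c" for y
    using that Placed_in_builds[OF c(1)] by (auto simp: h'_def)
  have "relabel h' u' = u" "relabel h' v' = v"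
    using c' old by (auto intro!: relabel_cong)
  then have m: "m = relabel h' d"
    using relabel_replacement[of h' x ?j 0] by (simp add: uv(3) d_def h'_def)
  have "count_list u' Slot = count_list u Slot"
    using c'(2) by auto
  then have "insertion_step ?j x c d"
    unfolding insertion_step_def using c'(1) uv(2) by (intro exI[of _ u'] exI[of _ v']) (simp add: d_def)
  then have d: "builds (w @ [x]) d" using c(1) by (rule builds.step[rotated])
  have mem: "Placed y \<in> set d \<longleftrightarrow> Placed y \<in> set c \<or> y = ?j" for y
    using Placed_in_builds[OF d, of y] Placed_in_builds[OF c(1), of y] by auto
  have "\<exists>x<y. Placed x \<in> set d \<and> h' x = Some a"
    if y: "Placed y \<in> set d" "h' y = Some b" "pop_less P a b" for y a b
  proof (cases "y = ?j")
    case True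
    then have "Placed a \<in> set (relabel h c)" using l y c(2) by (simp add: h'_def)
    then show ?thesis using True old mem by (metis Placed_in_relabel)
  next
    case False
    then show ?thesis using y ord[of y b a] mem old by metis
  qed
  then show ?case using d m by blast
qed

text \<open>A labelling fixed in advance is guessed step by step. By \<open>ord\<close>,
  predecessors carry smaller values and are marked in time; the slot bound and injectivity keep the
  run inside \<open>marked_configs\<close>.\<close>

lemma markings_complete:
  assumes "builds w c"
    and "\<And>w1 w2 c1. w = w1 @ w2 \<Longrightarrow> builds w1 c1 \<Longrightarrow> count_list c1 Slot \<le> B"
    and ran: "\<And>x a. h x = Some a \<Longrightarrow> a \<in> {1..k}"
    and inj: "\<And>x y a. h x = Some a \<Longrightarrow> h y = Some a \<Longrightarrow> x = y"
    and ord: "\<And>y a b. h y = Some b \<Longrightarrow> pop_less P a b \<Longrightarrow> \<exists>x<y. 1 \<le> x \<and> h x = Some a"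
  shows "relabel h c \<in> markings k P B w"
  using assms(1,2)
proof (induction rule: builds.induct)
  case start
  then show ?case by simp
next
  case (step w c x c')
  let ?j = "Suc (length w)"
  have IH: "relabel h c \<in> markings k P B w" using step.IH step.prems by simp
  obtain u v where uv: "c = u @ Slot # v" "slot_index x = Suc (count_list u Slot)"
    "c' = u @ replacement x ?j @ v" using step.hyps(2) by (auto elim: insertion_stepE)
  have "Placed a \<in> set (relabel h c)" if "h ?j = Some b" "pop_less P a b" for a b
    using ord[OF that] Placed_in_builds[OF step.hyps(1)] by (auto simp: Placed_in_relabel)
  then have "mark_step P x (relabel h c) (relabel h c')"
    unfolding mark_step_def using uv relabel_replacement[of h x ?j 0]
    by (intro exI[of _ "relabel h u"] exI[of _ "relabel h v"] exI[of _ "h ?j"]) auto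
  moreover have "relabel h c' \<in> marked_configs k B"
  proof -
    have b: "builds (w @ [x]) c'" using step.hyps by (rule builds.step)
    have "set (relabel h c') \<subseteq> insert Slot (Placed ` {1..k})"
    proof
      fix s assume s: "s \<in> set (relabel h c')"
      show "s \<in> insert Slot (Placed ` {1..k})"
        by (cases s) (use s ran in \<open>auto simp: Placed_in_relabel\<close>)
    qed
    moreover have "sorted_wrt (\<noteq>) (vals c')" using builds_vals[OF b] by (simp add: distinct_iff_sorted_wrt)
    then have "sorted_wrt (\<noteq>) (vals (relabel h c'))"
      unfolding sorted_wrt_vals_relabel by (rule sorted_wrt_mono_rel[rotated]) (use inj in blast)
    ultimately show ?thesis
      using step.prems[of "w @ [x]" "[]"] b by (simp add: marked_configs_def distinct_iff_sorted_wrt)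
  qed
  ultimately show ?case using IH unfolding markings_snoc by blast
qed

text \<open>An empty set of markings stays empty, so every prefix has a marking, whose slots are
  those of the configuration. \<open>1 \<le> B\<close> covers the empty prefix.\<close>

lemma markings_slots_bounded:
  assumes "markings k P B w \<noteq> {}" "w = w1 @ w2" "builds w1 c1" "1 \<le> B"
  shows "count_list c1 Slot \<le> B"
proof -
  have empty: "foldl (mark_transition k P B) {} v = {}" for v
    by (induction v) (auto simp: mark_transition_def)
  have "markings k P B w1 \<noteq> {}" using assms(1,2) empty by auto
  then obtain m where m: "m \<in> markings k P B w1" by blast
  then obtain h where "m = relabel h c1" using markings_sound[OF m] builds_unique[OF assms(3)] by blast
  moreover have "count_list m Slot \<le> B"
    using m assms(4) by (cases w1 rule: rev_cases) (auto simp: markings_snoc marked_configs_def simp del: foldl_append)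
  ultimately show ?thesis by simp
qed

section \<open>Bipartite patterns\<close>

lemma builds_no_adjacent_slots: "builds w c \<Longrightarrow> successively (\<lambda>s t. s \<noteq> Slot \<or> t \<noteq> Slot) c"
proof (induction rule: builds.induct)
  case (step w c x c')
  from step(2) show ?case
    by (rule insertion_stepE)
      (use step.IH in \<open>cases x; auto simp: successively_append_iff successively_Cons\<close>)
qed simp

text \<open>A slot still open after \<open>j\<close> insertions receives only values above
  \<open>j\<close>, so it counts as high.\<close>

fun is_low :: "nat \<Rightarrow> symbol \<Rightarrow> bool" where
  "is_low j Slot \<longleftrightarrow> False"
| "is_low j (Placed x) \<longleftrightarrow> x \<le> j"

text \<open>After \<open>w\<close>, an insertion replaces a slot by a nonempty word of slots and
  high entries, so the low/high word only gains \<open>False\<close> letters.\<close>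

lemma builds_subseq_is_low:
  assumes "builds w c" "builds (w @ v) d" "j \<le> length w"
  shows "subseq (map (is_low j) c) (map (is_low j) d)"
  using assms(2)
proof (induction v arbitrary: d rule: rev_induct)
  case Nil
  then show ?case using builds_unique[OF assms(1)] by simp
next
  case (snoc x v)
  then obtain d0 where d0: "builds (w @ v) d0" "insertion_step (Suc (length (w @ v))) x d0 d"
    by (auto simp: builds_snoc simp flip: append_assoc)
  from d0(2) have "subseq (map (is_low j) d0) (map (is_low j) d)"
    by (rule insertion_stepE) (use assms(3) in \<open>cases x; auto intro!: list_emb_append_mono\<close>)
  with snoc.IH[OF d0(1)] show ?case by (rule subseq_order.trans)
qed

text \<open>Greedy matching uses at most one \<open>False\<close> per letter of \<open>bs\<close>: a
  wanted \<open>True\<close> is either present or directly follows the \<open>False\<close> skipped.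
  Strictness matters, as \<open>[False]\<close> contains no \<open>True\<close>.\<close>

lemma subseq_if_many_False:
  "successively (\<or>) xs \<Longrightarrow> length bs < count_list xs False \<Longrightarrow> subseq bs xs"
proof (induction xs arbitrary: bs rule: induct_list012)
  case (2 x)
  then show ?case by (auto split: if_splits)
next
  case (3 x y xs)
  show ?case
  proof (cases bs)
    case (Cons b bs')
    have succ: "successively (\<or>) (y # xs)" "successively (\<or>) xs" "x \<or> y"
      using "3.prems"(1) by (auto simp: successively_Cons)
    consider "x = b" | "x" "\<not> b" | "\<not> x" "y" "b" using succ(3) by blast
    then show ?thesis
    proof cases
      case 1
      then have "subseq bs' (y # xs)"
        using "3.prems"(2) Cons by (intro "3.IH"(2) succ) (auto split: if_splits)
      then show ?thesis using 1 Cons by simp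
    next
      case 2
      then have "subseq bs (y # xs)"
        using "3.prems"(2) by (intro "3.IH"(2) succ) simp
      then show ?thesis by (rule list_emb_Cons)
    next
      case 3
      then have "subseq bs' xs"
        using "3.prems"(2) Cons by (intro "3.IH"(1) succ) simp
      then have "subseq bs (y # xs)" using 3 Cons by simp
      then show ?thesis by (rule list_emb_Cons)
    qed
  qed simp
qed simp

lemma subseq_nth_embedding:
  "subseq xs ys \<Longrightarrow> \<exists>f. strict_mono_on {..<length xs} f \<and>
    (\<forall>i<length xs. f i < length ys \<and> ys ! f i = xs ! i)"
proof (induction rule: list_emb.induct)
  case (list_emb_Nil ys)
  then show ?case by (auto simp: strict_mono_on_def)
next
  case (list_emb_Cons xs ys y)
  then obtain f where "strict_mono_on {..<length xs} f"
    "\<forall>i<length xs. f i < length ys \<and> ys ! f i = xs ! i" by blast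
  then show ?case by (intro exI[of _ "Suc \<circ> f"]) (auto simp: strict_mono_on_def)
next
  case (list_emb_Cons2 x y xs ys)
  then obtain f where f: "strict_mono_on {..<length xs} f"
    "\<forall>i<length xs. f i < length ys \<and> ys ! f i = xs ! i" by blast
  define g where "g = case_nat 0 (Suc \<circ> f)"
  have "strict_mono_on {..<length (x # xs)} g"
    using f(1) by (auto simp: strict_mono_on_def g_def split: nat.splits)
  moreover have "g i < length (y # ys) \<and> (y # ys) ! g i = (x # xs) ! i" if "i < length (x # xs)" for i
    using f(2) that list_emb_Cons2(1) by (cases i) (auto simp: g_def)
  ultimately show ?case by blast
qed

text \<open>If more than \<open>k\<close> slots are open after \<open>j\<close> insertions, then low and high entries (at most,
  respectively above, \<open>j\<close>) occur in every prescribed order of length \<open>k\<close>; let the elements that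
  lie below some other element of \<open>P\<close> be low and the others high.\<close>

lemma avoiding_bipartite_slots_bounded:
  assumes bip: "bipartite_pop P" and "\<not> contains_pop \<pi> k P" "encodes (w @ v) \<pi>" "builds w c"
  shows "count_list c Slot \<le> k"
proof (rule ccontr)
  assume many: "\<not> count_list c Slot \<le> k"
  let ?j = "length w"
  \<comment> \<open>\<open>True\<close> prescribes a low entry; index \<open>a\<close> stands for
    the element \<open>Suc a\<close>, since lists are indexed from 0.\<close>
  define bs where "bs = map (\<lambda>a. \<exists>b. pop_less P (Suc a) b) [0..<k]"
  have "\<And>s. s \<in> set c \<Longrightarrow> is_low ?j s \<longleftrightarrow> s \<noteq> Slot"
    using Placed_in_builds[OF assms(4)] by (metis is_low.elims(1) symbol.distinct(1))
  then have low: "map (is_low ?j) c = map (\<lambda>s. s \<noteq> Slot) c" by simp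
  have "count_list (map (\<lambda>s. s \<noteq> Slot) c) False = count_list c Slot"
    by (induction c) auto
  then have "subseq bs (map (is_low ?j) c)"
    unfolding low using many builds_no_adjacent_slots[OF assms(4)]
    by (intro subseq_if_many_False) (auto simp: successively_map bs_def)
  also have "subseq (map (is_low ?j) c) (map (is_low ?j) (map Placed \<pi>))"
    using assms(3,4) by (intro builds_subseq_is_low) (auto simp: encodes_def)
  finally obtain f where f: "strict_mono_on {..<k} f"
    "\<forall>i<k. f i < length \<pi> \<and> map (is_low ?j) (map Placed \<pi>) ! f i = bs ! i"
    using subseq_nth_embedding[of bs "map (is_low ?j) (map Placed \<pi>)"] by (auto simp: bs_def)
  have f_low: "\<pi> ! f i \<le> ?j \<longleftrightarrow> (\<exists>b. pop_less P (Suc i) b)" "f i < length \<pi>" if "i < k" for i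
    using f(2) that by (auto simp: bs_def)
  define e where "e a = Suc (f (a - 1))" for a
  have "strict_mono_on {1..k} e"
    unfolding e_def by (intro strict_mono_onI) (auto intro!: strict_mono_onD[OF f(1)])
  moreover have "e ` {1..k} \<subseteq> {1..length \<pi>}"
    unfolding e_def by (auto simp: Suc_le_eq intro!: f_low(2))
  moreover have "entry \<pi> (e a) < entry \<pi> (e b)"
    if ab: "a \<in> {1..k}" "b \<in> {1..k}" "pop_less P a b" for a b
  proof -
    have "a - 1 < k" "b - 1 < k" using ab by auto
    have "\<pi> ! f (a - 1) \<le> ?j" using f_low(1)[OF \<open>a - 1 < k\<close>] ab by auto
    \<comment> \<open>Height at most two enters here: \<open>b\<close> lies above \<open>a\<close>,
      so nothing lies above \<open>b\<close> and its entry is high.\<close>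
    moreover have "\<not> \<pi> ! f (b - 1) \<le> ?j"
      using f_low(1)[OF \<open>b - 1 < k\<close>] ab bip by (auto simp: bipartite_pop_def)
    ultimately show ?thesis by (simp add: entry_def e_def)
  qed
  ultimately show False using assms(2) unfolding contains_pop_def by blast
qed

section \<open>Full markings and occurrences of the pattern\<close>

text \<open>The marking \<open>1, ..., k\<close> makes each label occur once and increase with
  position, while soundness supplies the inequalities between values.\<close>

lemma full_marking_imp_contains:
  assumes "map Placed [1..<Suc k] \<in> markings k P B w" "encodes w \<pi>"
  shows "contains_pop \<pi> k P"
proof -
  obtain h
    where h: "map Placed [1..<Suc k] = relabel h (map Placed \<pi>)"
      and ord: "\<And>y a b. \<lbrakk>y \<in> set \<pi>; h y = Some b; pop_less P a b\<rbrakk> \<Longrightarrow>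
        \<exists>x<y. x \<in> set \<pi> \<and> h x = Some a"
  proof -
    obtain c h where c: "builds w c" "map Placed [1..<Suc k] = relabel h c"
      "\<And>y a b. \<lbrakk>Placed y \<in> set c; h y = Some b; pop_less P a b\<rbrakk> \<Longrightarrow>
         \<exists>x<y. Placed x \<in> set c \<and> h x = Some a"
      using markings_sound[OF assms(1)] by blast
    have "c = map Placed \<pi>" using c(1) assms(2) unfolding encodes_def by (rule builds_unique)
    then have mem: "Placed x \<in> set c \<longleftrightarrow> x \<in> set \<pi>" for x by auto
    show thesis
      by (rule that[of h]) (use c(2) \<open>c = map Placed \<pi>\<close> in simp, use c(3) mem in blast)
  qed
  have vals: "vals (relabel h (map Placed \<pi>)) = [1..<Suc k]"
    using vals_map_Placed[of "[1..<Suc k]"] unfolding h .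
  have sorted: "sorted_wrt (<) (vals (relabel h (map Placed \<pi>)))"
    unfolding vals by (rule sorted_wrt_upt)
  have srt: "a < b" if "p < q" "q < length \<pi>" "h (\<pi> ! p) = Some a" "h (\<pi> ! q) = Some b" for p q a b
    using sorted[unfolded sorted_wrt_vals_relabel, unfolded vals_map_Placed sorted_wrt_iff_nth_less]
      that by blast
  then have uniq: "p = q"
    if "p < length \<pi>" "q < length \<pi>" "h (\<pi> ! p) = Some a" "h (\<pi> ! q) = Some a" for p q a
    using that by (metis less_irrefl linorder_neqE_nat)
  have ex: "\<exists>p<length \<pi>. h (\<pi> ! p) = Some a" if "a \<in> {1..k}" for a
  proof -
    have "Placed a \<in> set (map Placed [1..<Suc k])" using that by auto
    then have "Placed a \<in> set (relabel h (map Placed \<pi>))" unfolding h .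
    then obtain x where "x \<in> set \<pi>" "h x = Some a" by (auto simp: Placed_in_relabel)
    then show ?thesis by (auto simp: in_set_conv_nth)
  qed
  define p where "p a = (SOME p. p < length \<pi> \<and> h (\<pi> ! p) = Some a)" for a
  have p: "p a < length \<pi>" "h (\<pi> ! p a) = Some a" if "a \<in> {1..k}" for a
    using someI_ex[OF ex[OF that]] unfolding p_def by auto
  have "strict_mono_on {1..k} (\<lambda>a. Suc (p a))"
  proof (rule strict_mono_onI)
    fix a b assume ab: "a \<in> {1..k}" "b \<in> {1..k}" "a < b"
    have "p a \<noteq> p b" using p[OF ab(1)] p[OF ab(2)] ab(3) by auto
    moreover have "\<not> p b < p a" using srt[of "p b" "p a" b a] p[OF ab(1)] p[OF ab(2)] ab(3) by auto
    ultimately show "Suc (p a) < Suc (p b)" by simp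
  qed
  moreover have "(\<lambda>a. Suc (p a)) ` {1..k} \<subseteq> {1..length \<pi>}"
    using p(1) by (fastforce simp: Suc_le_eq)
  moreover have "entry \<pi> (Suc (p a)) < entry \<pi> (Suc (p b))"
    if ab: "a \<in> {1..k}" "b \<in> {1..k}" "pop_less P a b" for a b
  proof -
    \<comment> \<open>Soundness yields some smaller value labelled \<open>a\<close>; uniqueness of
      labels identifies it with the entry at \<open>p a\<close>.\<close>
    obtain x where x: "x < \<pi> ! p b" "x \<in> set \<pi>" "h x = Some a"
      using ord[of "\<pi> ! p b" b a] p[OF ab(2)] ab(3) by auto
    then obtain q where "q < length \<pi>" "x = \<pi> ! q" by (metis in_set_conv_nth)
    then have "x = \<pi> ! p a" using uniq[of q "p a" a] p[OF ab(1)] x(3) by simp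
    then show ?thesis using x(1) by (simp add: entry_def)
  qed
  ultimately show ?thesis unfolding contains_pop_def by blast
qed

text \<open>An occurrence \<open>i\<close> labels the value at position \<open>i a\<close> by
  \<open>a\<close>. Guessing this labelling is a valid run, and its marks appear in the order of
  positions, that is, as \<open>1, ..., k\<close>.\<close>

lemma contains_imp_full_marking:
  assumes P: "P \<subseteq> {1..k} \<times> {1..k}" and "contains_pop \<pi> k P" and enc: "encodes w \<pi>"
    and bound: "\<And>w1 w2 c1. w = w1 @ w2 \<Longrightarrow> builds w1 c1 \<Longrightarrow> count_list c1 Slot \<le> B"
  shows "map Placed [1..<Suc k] \<in> markings k P B w"
proof -
  obtain i where i: "strict_mono_on {1..k} i" "i ` {1..k} \<subseteq> {1..length \<pi>}"
    "\<forall>a\<in>{1..k}. \<forall>b\<in>{1..k}. pop_less P a b \<longrightarrow> entry \<pi> (i a) < entry \<pi> (i b)"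
    using assms(2) unfolding contains_pop_def by blast
  have dist: "distinct \<pi>" and set: "set \<pi> = {1..length w}"
    using builds_vals[of w "map Placed \<pi>"] enc by (auto simp: encodes_def)
  have pos: "i a - 1 < length \<pi> \<and> i a \<ge> 1" if "a \<in> {1..k}" for a
    using i(2) that by (fastforce simp: image_subset_iff)
  have mono: "i a < i b \<longleftrightarrow> a < b" if "a \<in> {1..k}" "b \<in> {1..k}" for a b
    using strict_mono_on_less[OF i(1)] that by blast
  have inj: "a = b" if "entry \<pi> (i a) = entry \<pi> (i b)" "a \<in> {1..k}" "b \<in> {1..k}" for a b
  proof -
    have "i a - 1 = i b - 1"
      using that pos dist by (simp add: entry_def nth_eq_iff_index_eq)
    moreover have "1 \<le> i a" "1 \<le> i b" using pos that by blast+
    ultimately have "i a = i b" by linarith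
    then show ?thesis using mono[of a b] mono[of b a] that by (metis less_irrefl linorder_neqE_nat)
  qed
  define h where "h x = (if \<exists>a\<in>{1..k}. entry \<pi> (i a) = x
    then Some (THE a. a \<in> {1..k} \<and> entry \<pi> (i a) = x) else None)" for x
  have h: "h x = Some a \<longleftrightarrow> a \<in> {1..k} \<and> entry \<pi> (i a) = x" for x a
  proof -
    have "(THE b. b \<in> {1..k} \<and> entry \<pi> (i b) = x) = a" if "a \<in> {1..k}" "entry \<pi> (i a) = x" for a
      by (rule the_equality) (use that inj in blast)+
    then show ?thesis unfolding h_def by (smt (verit) option.inject option.distinct(1))
  qed
  have "relabel h (map Placed \<pi>) \<in> markings k P B w"
  proof (rule markings_complete)
    show "builds w (map Placed \<pi>)" using enc by (simp add: encodes_def)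
    fix y a b assume y: "h y = Some b" "pop_less P a b"
    then have a: "a \<in> {1..k}" using P by (auto simp: pop_less_def)
    have "entry \<pi> (i a) \<in> set \<pi>" using pos[OF a] by (simp add: entry_def)
    then have "1 \<le> entry \<pi> (i a)" using set by simp
    moreover have "entry \<pi> (i a) < y" using y i(3) a by (auto simp: h)
    ultimately show "\<exists>x<y. 1 \<le> x \<and> h x = Some a" using a by (auto simp: h)
  qed (auto simp: h bound)
  moreover have "vals (relabel h (map Placed \<pi>)) = [1..<Suc k]"
  proof (rule strict_sorted_equal)
    show "sorted_wrt (<) (vals (relabel h (map Placed \<pi>)))"
      unfolding sorted_wrt_vals_relabel
      unfolding vals_map_Placed sorted_wrt_iff_nth_less
    proof (intro allI impI)
      fix p q a b assume pq: "p < q" "q < length \<pi>" "h (\<pi> ! p) = Some a" "h (\<pi> ! q) = Some b"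
      then have a: "a \<in> {1..k}" "\<pi> ! (i a - 1) = \<pi> ! p" and b: "b \<in> {1..k}" "\<pi> ! (i b - 1) = \<pi> ! q"
        by (auto simp: h entry_def)
      then have "i a - 1 = p" "i b - 1 = q"
        using dist pq(1,2) pos by (auto simp: nth_eq_iff_index_eq)
      then have "i a < i b" using pq(1) by simp
      then show "a < b" using mono a b by blast
    qed
    show "set (vals (relabel h (map Placed \<pi>))) = set [1..<Suc k]"
      unfolding set_upt atLeastLessThanSuc_atLeastAtMost
    proof (intro equalityI subsetI)
      fix a assume a: "a \<in> {1..k}"
      then have "entry \<pi> (i a) \<in> set \<pi>" using pos[OF a] by (simp add: entry_def)
      then show "a \<in> set (vals (relabel h (map Placed \<pi>)))"
        using a h by (auto simp: set_vals Placed_in_relabel)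
    qed (auto simp: set_vals Placed_in_relabel h)
  qed (rule sorted_wrt_upt)
  moreover have "map Placed (vals (relabel h (map Placed \<pi>))) = relabel h (map Placed \<pi>)"
    by (rule map_Placed_vals) (simp flip: count_list_0_iff)
  ultimately show ?thesis by metis
qed

lemma bipartite_imp_regular:
  assumes P: "P \<subseteq> {1..k} \<times> {1..k}" and bip: "bipartite_pop P"
  shows "has_regular_insertion_encoding (Av k P)"
proof -
  \<comment> \<open>\<open>Suc k\<close> instead of \<open>k\<close> admits the initial slot even
    when \<open>k = 0\<close>.\<close>
  let ?B = "Suc k" and ?full = "map Placed [1..<Suc k]"
  define \<Sigma> where "\<Sigma> = {x. slot_index x \<le> ?B}"
  \<comment> \<open>\<open>[]\<close> certifies that no slot is left; absence of
    \<open>?full\<close> says that no run of guesses finds an occurrence, a condition on all runs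
    that the subset construction makes testable.\<close>
  define F where "F = {S \<in> Pow (marked_configs k ?B). [] \<in> S \<and> ?full \<notin> S}"
  have "x \<in> (\<Union>i\<le>?B. {Lf i, Ll i, Lr i, Lm i})" if "x \<in> \<Sigma>" for x
    using that by (cases x) (auto simp: \<Sigma>_def)
  then have "finite \<Sigma>" by (rule finite_subset[OF subsetI]) auto
  have start: "{[Slot]} \<in> Pow (marked_configs k ?B)" by (simp add: marked_configs_def)
  have closed: "mark_transition k P ?B S x \<in> Pow (marked_configs k ?B)" for S x
    by (auto simp: mark_transition_def)
  have reach: "markings k P ?B w \<in> Pow (marked_configs k ?B)" for w
    using start closed by (cases w rule: rev_cases) auto
  have "w \<in> encodings (Av k P) \<longleftrightarrow> w \<in> lists \<Sigma> \<and> markings k P ?B w \<in> F" for w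
  proof
    assume "w \<in> encodings (Av k P)"
    then obtain \<pi> where \<pi>: "encodes w \<pi>" "\<not> contains_pop \<pi> k P" by (auto simp: encodings_def Av_def)
    then have bound: "count_list c1 Slot \<le> ?B" if "w = w1 @ w2" "builds w1 c1" for w1 w2 c1
      using avoiding_bipartite_slots_bounded[OF bip \<pi>(2), of w1 w2 c1] that by simp
    have "x \<in> \<Sigma>" if x: "x \<in> set w" for x
    proof -
      obtain w1 w2 where w: "w = (w1 @ [x]) @ w2" using split_list[OF x] by auto
      obtain c c' where c: "builds w1 c" "insertion_step (Suc (length w1)) x c c'"
        using builds_prefix[of "w1 @ [x]" w2] \<pi>(1) unfolding encodes_def w builds_snoc by blast
      from c(2) have "slot_index x \<le> count_list c Slot" by (rule insertion_stepE) auto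
      also have "\<dots> \<le> ?B" using bound[of w1 "x # w2"] w c(1) by simp
      finally show ?thesis by (simp add: \<Sigma>_def)
    qed
    \<comment> \<open>The run that assigns no roles ends in \<open>[]\<close>.\<close>
    moreover have "relabel (\<lambda>_. None) (map Placed \<pi>) \<in> markings k P ?B w"
      by (rule markings_complete) (use \<pi>(1) bound in \<open>auto simp: encodes_def\<close>)
    moreover have "relabel (\<lambda>_. None) (map Placed \<pi>) = []" by (induction \<pi>) auto
    moreover have "?full \<notin> markings k P ?B w"
      using full_marking_imp_contains[OF _ \<pi>(1)] \<pi>(2) by blast
    ultimately show "w \<in> lists \<Sigma> \<and> markings k P ?B w \<in> F"
      using reach[of w] by (simp add: F_def in_lists_conv_set del: upt_Suc)
  next
    assume w: "w \<in> lists \<Sigma> \<and> markings k P ?B w \<in> F"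
    then have nil: "[] \<in> markings k P ?B w" and full: "?full \<notin> markings k P ?B w"
      by (auto simp: F_def)
    obtain c h where c: "builds w c" "[] = relabel h c" using markings_sound[OF nil] by blast
    then have "Slot \<notin> set c" by (metis count_Slot_relabel count_list.simps(1) count_list_0_iff)
    then have enc: "encodes w (vals c)" using c(1) by (intro builds_slotless_encodes)
    have "count_list c1 Slot \<le> ?B" if "w = w1 @ w2" "builds w1 c1" for w1 w2 c1
      using markings_slots_bounded[of k P ?B w w1 w2 c1] nil that by auto
    then have "\<not> contains_pop (vals c) k P"
      using contains_imp_full_marking[OF P _ enc] full by blast
    then show "w \<in> encodings (Av k P)"
      using enc encodes_perms by (auto simp: encodings_def Av_def)
  qed
  then have "encodings (Av k P) = {w \<in> lists \<Sigma>. markings k P ?B w \<in> F}" by blast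
  moreover have "regular_language {w \<in> lists \<Sigma>. markings k P ?B w \<in> F}"
    using \<open>finite \<Sigma>\<close> start closed
    by (intro regular_languageI[where Q = "Pow (marked_configs k ?B)"])
      (auto simp: finite_marked_configs F_def)
  ultimately show ?thesis by (simp add: has_regular_insertion_encoding_def)
qed

theorem theorem2:
  fixes k :: nat and P :: "nat rel"
  assumes "partial_order_on {1..k} P"
  shows "has_regular_insertion_encoding (Av k P) \<longleftrightarrow> bipartite_pop P"
  using regular_imp_bipartite bipartite_imp_regular partial_order_onD(4)[OF assms] by blast

end
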